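(* Let $P(x)=\sum_{i=0}^n P_i x^i\in\mathbb C[x]^{m\times m}$ be a regular matrix polynomial of degree $n$, let $q$ be an integer with $0<q\le n$, and let $B_1(x),\ldots,B_q(x),W_1(x),\ldots,W_q(x)\in\mathbb C[x]^{m\times m}$ be such that $$P(x)=\prod_{i=1}^q B_i(x)+\sum_{i=1}^q W_i(x)\prod_{j=1,\,j\ne i}^q B_j(x),$$ where the $B_i(x)$ are regular, commute with each other, and are pairwise right co-prime. Let $$A(x)=\operatorname{diag}(B_1(x),\ldots,B_q(x))+(e\otimes I_m)[W_1(x),\ldots,W_q(x)],\qquad e=(1,\ldots,1)^t\in\mathbb C^q.$$ Let $\lambda\in\mathbb C$ be such that $\det P(\lambda)=0$ and assume that $\det B_i(\lambda)\ne 0$ for all $i=1,\ldots,q$. If $v_A=(v_1^t,\ldots,v_q^t)^t\in\mathbb C^{mq}$ (with $v_i\in\mathbb C^m$) is such that $A(\lambda)v_A=0$ and $v_A\ne 0$, then $P(\lambda)v=0$, where $$v=-\Big(\prod_{i=1}^q B_i(\lambda)^{-1}\Big)\sum_{j=1}^q W_j(\lambda)v_j\ne 0.$$ Conversely, if $v\in\mathbb C^m$ is a nonzero vector such that $P(\lambda)v=0$, then the vector $v_A=(v_1^t,\ldots,v_q^t)^t$ defined by $v_i=\prod_{j\ne i}B_j(\lambda)v$, $i=1,\ldots,q$, is nonzero and such that $A(\lambda)v_A=0$.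
   Context: $\mathbb C[x]^{m\times m}$ is the set of $m\times m$ matrix polynomials over $\mathbb C$; $P$ has degree $n$ if $P_n\neq 0$. A matrix polynomial is regular if its determinant is not identically zero. Two matrix polynomials $B(x),B'(x)\in\mathbb C[x]^{m\times m}$ are right co-prime if there exist $\alpha(x),\beta(x)\in\mathbb C[x]^{m\times m}$ with $B(x)\alpha(x)+B'(x)\beta(x)=I_m$; "pairwise" refers to all pairs with distinct indices. $\operatorname{diag}(B_1,\ldots,B_q)$ is the block diagonal matrix with these $m\times m$ blocks. The superscript $t$ denotes transpose. *)

theory Defs
  imports
    "HOL-Computational_Algebra.Polynomial"
    "Jordan_Normal_Form.Determinant"
    "Jordan_Normal_Form.Gauss_Jordan_Elimination"
begin

(* An m x m matrix polynomial over the complex numbers is an element of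
   carrier_mat m m :: complex poly mat set, i.e. a matrix with polynomial entries.
   Families B_1, ..., B_q are functions on nat, used at the indices 0, ..., q - 1. *)

definition finsum_mat ::
  "'a :: monoid_add itself \<Rightarrow> nat \<Rightarrow> nat \<Rightarrow> ('c \<Rightarrow> 'a mat) \<Rightarrow> 'c set \<Rightarrow> 'a mat" where
  "finsum_mat ty nr nc = finprod (monoid_mat ty nr nc)"

(* M_1 * ... * M_k in list order; the empty product is the m x m identity. *)
definition prod_list_mat :: "nat \<Rightarrow> 'a :: semiring_1 mat list \<Rightarrow> 'a mat" where
  "prod_list_mat m Ms = foldr (*) Ms (1\<^sub>m m)"

definition matpoly_of_coeffs :: "nat \<Rightarrow> nat \<Rightarrow> (nat \<Rightarrow> complex mat) \<Rightarrow> complex poly mat" where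
  "matpoly_of_coeffs m n C =
     finsum_mat TYPE(complex poly) m m (\<lambda>i. monom 1 i \<cdot>\<^sub>m map_mat (\<lambda>c. [:c:]) (C i)) {..n}"

definition eval_matpoly :: "complex poly mat \<Rightarrow> complex \<Rightarrow> complex mat" where
  "eval_matpoly M z = map_mat (\<lambda>p. poly p z) M"

definition regular_matpoly :: "complex poly mat \<Rightarrow> bool" where
  "regular_matpoly M \<longleftrightarrow> det M \<noteq> 0"

definition right_coprime :: "nat \<Rightarrow> complex poly mat \<Rightarrow> complex poly mat \<Rightarrow> bool" where
  "right_coprime m B B' \<longleftrightarrow>
     (\<exists>\<alpha>\<in>carrier_mat m m. \<exists>\<beta>\<in>carrier_mat m m. B * \<alpha> + B' * \<beta> = 1\<^sub>m m)"

definition kronecker :: "'a :: times mat \<Rightarrow> 'a mat \<Rightarrow> 'a mat" where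
  "kronecker A B = mat (dim_row A * dim_row B) (dim_col A * dim_col B)
     (\<lambda>(i, j). A $$ (i div dim_row B, j div dim_col B) * B $$ (i mod dim_row B, j mod dim_col B))"

(* The m x (q m) block row [W_0, ..., W_(q-1)]. *)
definition block_row :: "nat \<Rightarrow> nat \<Rightarrow> (nat \<Rightarrow> 'a mat) \<Rightarrow> 'a mat" where
  "block_row m q W = mat m (q * m) (\<lambda>(i, j). W (j div m) $$ (i, j mod m))"

(* The vector of length q m obtained by stacking v_0, ..., v_(q-1), each of length m. *)
definition block_vec :: "nat \<Rightarrow> nat \<Rightarrow> (nat \<Rightarrow> 'a vec) \<Rightarrow> 'a vec" where
  "block_vec m q v = vec (q * m) (\<lambda>i. v (i div m) $ (i mod m))"

(* diag(B_1, ..., B_q) + (e \<otimes> I_m) [W_1, ..., W_q], with e the column of q ones. *)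
definition linearization_mat ::
  "nat \<Rightarrow> nat \<Rightarrow> (nat \<Rightarrow> complex poly mat) \<Rightarrow> (nat \<Rightarrow> complex poly mat) \<Rightarrow> complex poly mat" where
  "linearization_mat m q B W =
     diag_block_mat (map B [0..<q]) + kronecker (mat q 1 (\<lambda>_. 1)) (1\<^sub>m m) * block_row m q W"

end

theory Submission imports Defs
begin

text \<open>
  Everything happens at the single point \<open>z\<close>. Write \<open>b i\<close> and \<open>w i\<close> for the values of \<open>B i\<close> and
  \<open>W i\<close> at \<open>z\<close>, \<open>N\<close> for the product of all \<open>b j\<close>, \<open>N' i\<close> for the product over \<open>j \<noteq> i\<close>, and
  \<open>s u\<close> for the sum of the vectors \<open>w j *\<^sub>v u j\<close>. Two identities carry the proof:

  \<^item> Because every block row of \<open>(e \<otimes> I) [W]\<close> is the same row \<open>[W]\<close>, the linearization maps the stacked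
    vector of \<open>u\<close> to the stacked vector with blocks \<open>b i *\<^sub>v u i + s u\<close>
    (\<open>eval_linearization_mult_block_vec\<close>). Its kernel is therefore given by \<open>b i *\<^sub>v u i = - s u\<close> for
    all \<open>i\<close>.
  \<^item> The decomposition of \<open>P\<close> says that \<open>P\<close> maps \<open>v\<close> to \<open>N *\<^sub>v v + s u\<close> with \<open>u i = N' i *\<^sub>v v\<close>.

  Since the factors commute, \<open>N = b i * N' i\<close> for every \<open>i\<close> (\<open>prod_list_mat_factor_out\<close>). If \<open>P\<close>
  kills \<open>v\<close>, then \<open>b i *\<^sub>v u i = N *\<^sub>v v = - s u\<close> for \<open>u i = N' i *\<^sub>v v\<close>, which is the kernel condition;
  and \<open>u\<close> is nonzero because \<open>N\<close> is invertible and factors through each \<open>N' i\<close>. Conversely, for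
  \<open>u\<close> in the kernel put \<open>v = - N\<^sup>-\<^sup>1 s u\<close>. The vectors \<open>N' i *\<^sub>v v\<close> and \<open>u i\<close> both have the image
  \<open>- s u\<close> under the invertible matrix \<open>b i\<close>, so they are equal; hence \<open>P\<close> maps \<open>v\<close> to
  \<open>- s u + s u = 0\<close>, and \<open>v = 0\<close> would force all \<open>u i\<close> to vanish. Commutativity is used a second
  time in \<open>prod_list_mat_left_inverse\<close>: it makes the product of the inverses, taken in the same
  order as the factors, the inverse of \<open>N\<close>.
\<close>

section \<open>Sums and evaluation of matrix polynomials\<close>

text \<open>
  The two conclusions are proved together because the entries of \<open>M x + S\<close> can be read off only once
  the partial sum \<open>S\<close> is known to have the right dimensions.
\<close>

lemma finsum_mat_carrier_and_index:
  fixes M :: "'c \<Rightarrow> 'a :: comm_monoid_add mat"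
  assumes "finite I" and "\<And>k. k \<in> I \<Longrightarrow> M k \<in> carrier_mat nr nc"
  shows "finsum_mat TYPE('a) nr nc M I \<in> carrier_mat nr nc \<and>
    (\<forall>i<nr. \<forall>j<nc. finsum_mat TYPE('a) nr nc M I $$ (i, j) = (\<Sum>k\<in>I. M k $$ (i, j)))"
  using assms
proof (induction I rule: finite_induct)
  case empty
  interpret comm_monoid "monoid_mat TYPE('a) nr nc" by (rule comm_monoid_mat)
  show ?case
    by (simp add: finsum_mat_def) (simp add: monoid_mat_def)
next
  case (insert x F)
  interpret comm_monoid "monoid_mat TYPE('a) nr nc" by (rule comm_monoid_mat)
  have "M \<in> F \<rightarrow> carrier (monoid_mat TYPE('a) nr nc)" "M x \<in> carrier (monoid_mat TYPE('a) nr nc)"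
    using insert.prems by (auto simp: monoid_mat_def)
  then have "finsum_mat TYPE('a) nr nc M (insert x F) = M x + finsum_mat TYPE('a) nr nc M F"
    unfolding finsum_mat_def using insert.hyps
    by (subst finprod_insert) (auto simp: monoid_mat_def)
  then show ?case
    using insert by auto
qed

lemmas finsum_mat_carrier = finsum_mat_carrier_and_index[THEN conjunct1]
lemmas index_finsum_mat = finsum_mat_carrier_and_index[THEN conjunct2, rule_format]

lemma finsum_vec_carrier:
  fixes f :: "'c \<Rightarrow> 'a :: comm_monoid_add vec"
  assumes "\<And>k. k \<in> I \<Longrightarrow> f k \<in> carrier_vec n"
  shows "finsum_vec TYPE('a) n f I \<in> carrier_vec n"
  using assms by (intro finsum_vec_closed) auto

lemma finsum_vec_cong:
  fixes f g :: "'c \<Rightarrow> 'a :: comm_monoid_add vec"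
  assumes "finite I" and f: "\<And>k. k \<in> I \<Longrightarrow> f k \<in> carrier_vec n"
    and fg: "\<And>k. k \<in> I \<Longrightarrow> f k = g k"
  shows "finsum_vec TYPE('a) n f I = finsum_vec TYPE('a) n g I"
proof -
  have g: "g k \<in> carrier_vec n" if "k \<in> I" for k
    using f[OF that] fg[OF that] by simp
  have F: "finsum_vec TYPE('a) n f I \<in> carrier_vec n"
    by (rule finsum_vec_carrier) (rule f)
  have G: "finsum_vec TYPE('a) n g I \<in> carrier_vec n"
    by (rule finsum_vec_carrier) (rule g)
  show ?thesis
    using F G f g fg assms(1) by (intro eq_vecI) (auto simp: index_finsum_vec Pi_def)
qed

lemma mult_mat_vec_zero:
  fixes M :: "'a :: semiring_0 mat"
  shows "M \<in> carrier_mat nr nc \<Longrightarrow> M *\<^sub>v 0\<^sub>v nc = 0\<^sub>v nr"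
  by (intro eq_vecI) auto

lemma uminus_vec_eqI:
  fixes x y :: "'a :: ab_group_add vec"
  assumes "x \<in> carrier_vec n" "y \<in> carrier_vec n" "x + y = 0\<^sub>v n"
  shows "- y = x"
proof (rule eq_vecI)
  fix k assume "k < dim_vec x"
  then have k: "k < n" using assms(1) by simp
  then have "(x + y) $ k = 0" by (simp add: assms(3))
  then have "x $ k + y $ k = 0" "k < dim_vec y"
    using k assms(2) by auto
  then show "(- y) $ k = x $ k"
    by (simp add: minus_unique add.commute)
qed (use assms in auto)

lemma finsum_mat_mult_vec:
  fixes M :: "'c \<Rightarrow> 'a :: comm_semiring_0 mat"
  assumes "finite I" and M: "\<And>k. k \<in> I \<Longrightarrow> M k \<in> carrier_mat nr nc" and v: "v \<in> carrier_vec nc"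
  shows "finsum_mat TYPE('a) nr nc M I *\<^sub>v v = finsum_vec TYPE('a) nr (\<lambda>k. M k *\<^sub>v v) I"
proof (rule eq_vecI)
  note S = finsum_mat_carrier[of I M, OF assms(1) M]
  have "(\<lambda>k. M k *\<^sub>v v) \<in> I \<rightarrow> carrier_vec nr"
    using M v by (auto intro!: mult_mat_vec_carrier)
  then show "dim_vec (finsum_mat TYPE('a) nr nc M I *\<^sub>v v) = dim_vec (finsum_vec TYPE('a) nr (\<lambda>k. M k *\<^sub>v v) I)"
    using S finsum_vec_carrier[of I "\<lambda>k. M k *\<^sub>v v" nr] by fastforce
  fix i assume "i < dim_vec (finsum_vec TYPE('a) nr (\<lambda>k. M k *\<^sub>v v) I)"
  then have i: "i < nr"
    using M v finsum_vec_carrier[of I "\<lambda>k. M k *\<^sub>v v" nr] by fastforce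
  have "(finsum_mat TYPE('a) nr nc M I *\<^sub>v v) $ i = (\<Sum>j<nc. \<Sum>k\<in>I. M k $$ (i, j) * v $ j)"
    using S v i assms(1) M
    by (auto simp: scalar_prod_def index_finsum_mat sum_distrib_right lessThan_atLeast0)
  also have "\<dots> = (\<Sum>k\<in>I. (M k *\<^sub>v v) $ i)"
    using v i by (subst sum.swap) (auto simp: scalar_prod_def lessThan_atLeast0 dest!: M intro!: sum.cong)
  finally show "(finsum_mat TYPE('a) nr nc M I *\<^sub>v v) $ i = finsum_vec TYPE('a) nr (\<lambda>k. M k *\<^sub>v v) I $ i"
    using i assms(1) M v by (subst index_finsum_vec) (auto intro!: mult_mat_vec_carrier)
qed

lemma semiring_hom_poly: "semiring_hom (\<lambda>p. poly p (z :: 'a :: comm_semiring_1))"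
  by unfold_locales auto

lemma eval_matpoly_carrier [simp]:
  "eval_matpoly M z \<in> carrier_mat nr nc \<longleftrightarrow> M \<in> carrier_mat nr nc"
  by (auto simp: eval_matpoly_def)

lemma eval_matpoly_mult:
  assumes "M \<in> carrier_mat nr k" "N \<in> carrier_mat k nc"
  shows "eval_matpoly (M * N) z = eval_matpoly M z * eval_matpoly N z"
  unfolding eval_matpoly_def by (rule semiring_hom.mat_hom_mult[OF semiring_hom_poly assms])

lemma eval_matpoly_add:
  assumes "M \<in> carrier_mat nr nc" "N \<in> carrier_mat nr nc"
  shows "eval_matpoly (M + N) z = eval_matpoly M z + eval_matpoly N z"
  using assms by (intro eq_matI) (auto simp: eval_matpoly_def)

lemma eval_matpoly_finsum:
  assumes "finite I" "\<And>k. k \<in> I \<Longrightarrow> M k \<in> carrier_mat nr nc"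
  shows "eval_matpoly (finsum_mat TYPE(complex poly) nr nc M I) z =
    finsum_mat TYPE(complex) nr nc (\<lambda>k. eval_matpoly (M k) z) I"
proof -
  have 1: "finsum_mat TYPE(complex poly) nr nc M I \<in> carrier_mat nr nc"
    by (rule finsum_mat_carrier) (use assms in auto)
  have 2: "finsum_mat TYPE(complex) nr nc (\<lambda>k. eval_matpoly (M k) z) I \<in> carrier_mat nr nc"
    by (rule finsum_mat_carrier) (use assms in auto)
  show ?thesis
    using 1 2 assms
    by (intro eq_matI)
      (auto simp: eval_matpoly_def index_finsum_mat poly_sum dest!: assms(2) intro!: sum.cong)
qed

text \<open>
  Evaluation is a ring homomorphism in each entry, so a sum of products of matrix polynomials acts
  on a vector summand by summand and factor by factor. This turns the second part of the
  decomposition of \<open>P\<close> into a statement about complex vectors.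
\<close>

lemma eval_matpoly_finsum_mult_vec:
  assumes "finite I" and W: "\<And>i. i \<in> I \<Longrightarrow> W i \<in> carrier_mat nr k"
    and R: "\<And>i. i \<in> I \<Longrightarrow> R i \<in> carrier_mat k nc" and v: "v \<in> carrier_vec nc"
  shows "eval_matpoly (finsum_mat TYPE(complex poly) nr nc (\<lambda>i. W i * R i) I) z *\<^sub>v v =
    finsum_vec TYPE(complex) nr (\<lambda>i. eval_matpoly (W i) z *\<^sub>v (eval_matpoly (R i) z *\<^sub>v v)) I"
proof -
  have WR: "W i * R i \<in> carrier_mat nr nc" if "i \<in> I" for i
    using W[OF that] R[OF that] by (rule mult_carrier_mat)
  have "eval_matpoly (finsum_mat TYPE(complex poly) nr nc (\<lambda>i. W i * R i) I) z *\<^sub>v v =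
      finsum_mat TYPE(complex) nr nc (\<lambda>i. eval_matpoly (W i * R i) z) I *\<^sub>v v"
    using WR by (simp add: eval_matpoly_finsum[OF assms(1)])
  also have "\<dots> = finsum_vec TYPE(complex) nr (\<lambda>i. eval_matpoly (W i * R i) z *\<^sub>v v) I"
    using WR v by (intro finsum_mat_mult_vec assms(1)) auto
  also have "\<dots> = finsum_vec TYPE(complex) nr
      (\<lambda>i. eval_matpoly (W i) z *\<^sub>v (eval_matpoly (R i) z *\<^sub>v v)) I"
  proof (rule finsum_vec_cong[OF assms(1)])
    fix i assume i: "i \<in> I"
    show "eval_matpoly (W i * R i) z *\<^sub>v v \<in> carrier_vec nr"
      using WR[OF i] v by (auto intro!: mult_mat_vec_carrier[of _ nr nc])
    show "eval_matpoly (W i * R i) z *\<^sub>v v = eval_matpoly (W i) z *\<^sub>v (eval_matpoly (R i) z *\<^sub>v v)"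
      unfolding eval_matpoly_mult[OF W[OF i] R[OF i]]
      using W[OF i] R[OF i] v by (intro assoc_mult_mat_vec) auto
  qed
  finally show ?thesis .
qed

section \<open>Products of commuting matrices\<close>

lemma prod_list_mat_simps [simp]:
  "prod_list_mat m [] = 1\<^sub>m m"
  "prod_list_mat m (M # Ms) = M * prod_list_mat m Ms"
  by (simp_all add: prod_list_mat_def)

lemma prod_list_mat_carrier:
  "(\<And>M. M \<in> set Ms \<Longrightarrow> M \<in> carrier_mat m m) \<Longrightarrow> prod_list_mat m Ms \<in> carrier_mat m m"
  by (induction Ms) (auto intro!: mult_carrier_mat)

lemma eval_matpoly_prod_list:
  "(\<And>M. M \<in> set Ms \<Longrightarrow> M \<in> carrier_mat m m) \<Longrightarrow>
    eval_matpoly (prod_list_mat m Ms) z = prod_list_mat m (map (\<lambda>M. eval_matpoly M z) Ms)"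
proof (induction Ms)
  case Nil
  show ?case
    by (simp add: eval_matpoly_def semiring_hom.mat_hom_one[OF semiring_hom_poly])
next
  case (Cons M Ms)
  then show ?case
    by (simp add: eval_matpoly_mult[where nr = m and k = m and nc = m] prod_list_mat_carrier)
qed

lemma prod_list_mat_commute:
  assumes A: "A \<in> carrier_mat m m" and "\<And>M. M \<in> set Ms \<Longrightarrow> M \<in> carrier_mat m m"
    and "\<And>M. M \<in> set Ms \<Longrightarrow> A * M = M * A"
  shows "A * prod_list_mat m Ms = prod_list_mat m Ms * A"
  using assms(2,3)
proof (induction Ms)
  case Nil
  then show ?case using A by simp
next
  case (Cons M Ms)
  have M: "M \<in> carrier_mat m m" and N: "prod_list_mat m Ms \<in> carrier_mat m m"
    using Cons.prems by (auto intro: prod_list_mat_carrier)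
  have "A * (M * prod_list_mat m Ms) = M * A * prod_list_mat m Ms"
    using A M N Cons.prems by (simp flip: assoc_mult_mat[of _ m m _ m _ m])
  also have "\<dots> = M * (prod_list_mat m Ms * A)"
    using A M N Cons by (simp add: assoc_mult_mat[of _ m m _ m _ m])
  finally show ?case
    using A M N by (simp add: assoc_mult_mat[of _ m m _ m _ m])
qed

text \<open>
  The factor \<open>b x\<close> is moved to the front past the factors that precede it. Distinctness ensures that
  the filter removes exactly this one factor.
\<close>

lemma prod_list_mat_factor_out:
  assumes "x \<in> set xs" "distinct xs" "\<And>y. y \<in> set xs \<Longrightarrow> b y \<in> carrier_mat m m"
    and "\<And>y. y \<in> set xs \<Longrightarrow> b x * b y = b y * b x"
  shows "prod_list_mat m (map b xs) = b x * prod_list_mat m (map b (filter (\<lambda>y. y \<noteq> x) xs))"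
  using assms
proof (induction xs)
  case (Cons y ys)
  show ?case
  proof (cases "y = x")
    case True
    then have "filter (\<lambda>y. y \<noteq> x) ys = ys"
      using Cons.prems by (auto simp: filter_id_conv)
    then show ?thesis using True by simp
  next
    case False
    let ?N = "prod_list_mat m (map b (filter (\<lambda>y. y \<noteq> x) ys))"
    have c: "b x \<in> carrier_mat m m" "b y \<in> carrier_mat m m" "?N \<in> carrier_mat m m"
      using Cons.prems by (auto intro!: prod_list_mat_carrier)
    have "b y * (b x * ?N) = b y * b x * ?N"
      using c by (simp add: assoc_mult_mat[of _ m m _ m _ m])
    also have "b y * b x = b x * b y"
      using Cons.prems(4)[of y] by simp
    also have "b x * b y * ?N = b x * (b y * ?N)"
      using c by (simp add: assoc_mult_mat[of _ m m _ m _ m])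
    finally show ?thesis
      using False Cons c by (simp add: assoc_mult_mat[of _ m m _ m _ m])
  qed
qed simp

text \<open>
  The products are taken in the same order on both sides, whereas inverting a product reverses it.
  Induction therefore meets \<open>c x * C * (b x * B)\<close>, where \<open>b x\<close> has to pass the product \<open>C\<close> of the
  later \<open>c y\<close>; this is why commutation is required between the \<open>b x\<close> and the \<open>c y\<close>.
  The hypothesis is stated for all pairs so that the roles of \<open>b\<close> and \<open>c\<close> can be exchanged.
\<close>

lemma prod_list_mat_left_inverse:
  assumes "\<And>x. x \<in> set xs \<Longrightarrow> b x \<in> carrier_mat m m" "\<And>x. x \<in> set xs \<Longrightarrow> c x \<in> carrier_mat m m"
    and "\<And>x. x \<in> set xs \<Longrightarrow> c x * b x = 1\<^sub>m m"
    and "\<And>x y. x \<in> set xs \<Longrightarrow> y \<in> set xs \<Longrightarrow> b x * c y = c y * b x"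
  shows "prod_list_mat m (map c xs) * prod_list_mat m (map b xs) = 1\<^sub>m m"
  using assms
proof (induction xs)
  case (Cons x xs)
  let ?C = "prod_list_mat m (map c xs)" and ?B = "prod_list_mat m (map b xs)"
  have C: "?C \<in> carrier_mat m m" and B: "?B \<in> carrier_mat m m"
    and x: "b x \<in> carrier_mat m m" "c x \<in> carrier_mat m m"
    using Cons.prems by (auto intro!: prod_list_mat_carrier)
  have "b x * ?C = ?C * b x"
    using Cons.prems by (intro prod_list_mat_commute) auto
  then have "c x * ?C * (b x * ?B) = c x * (b x * ?C * ?B)"
    using C B x by (simp add: assoc_mult_mat[of _ m m _ m _ m])
  also have "\<dots> = c x * b x * (?C * ?B)"
    using C B x by (simp add: assoc_mult_mat[of _ m m _ m _ m])
  also have "\<dots> = 1\<^sub>m m"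
    using Cons by simp
  finally show ?case by simp
qed simp

lemma commute_inverse_mat:
  fixes a b c :: "'a :: semiring_1 mat"
  assumes a: "a \<in> carrier_mat m m" and b: "b \<in> carrier_mat m m" and c: "c \<in> carrier_mat m m"
    and "a * b = b * a" and cb: "c * b = 1\<^sub>m m" and bc: "b * c = 1\<^sub>m m"
  shows "a * c = c * a"
proof -
  have "a * c = c * b * (a * c)"
    using a c cb by simp
  also have "\<dots> = c * (b * a) * c"
    using a b c by (simp add: assoc_mult_mat[of _ m m _ m _ m])
  also have "\<dots> = c * (a * b) * c"
    using assms(4) by simp
  also have "\<dots> = c * a * (b * c)"
    using a b c by (simp add: assoc_mult_mat[of _ m m _ m _ m])
  finally show ?thesis using a c bc by simp
qed

lemma mat_inverse_of_det_nonzero: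
  fixes A :: "'a :: field mat"
  assumes A: "A \<in> carrier_mat m m" and "det A \<noteq> 0"
  shows "the (mat_inverse A) \<in> carrier_mat m m"
    "the (mat_inverse A) * A = 1\<^sub>m m" "A * the (mat_inverse A) = 1\<^sub>m m"
proof -
  have "mat_inverse A \<noteq> None"
    using det_non_zero_imp_unit[OF assms, of "()"] mat_inverse(1)[OF A, of "()"] by blast
  then show "the (mat_inverse A) \<in> carrier_mat m m"
    "the (mat_inverse A) * A = 1\<^sub>m m" "A * the (mat_inverse A) = 1\<^sub>m m"
    using mat_inverse(2)[OF A] by auto
qed

section \<open>Block vectors and the linearization\<close>

lemma block_index_less:
  fixes i k :: nat
  assumes "i < q" "k < m"
  shows "i * m + k < q * m"
proof -
  have "i * m + k < Suc i * m" using assms by simp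
  also have "\<dots> \<le> q * m" using assms by (intro mult_le_mono1) simp
  finally show ?thesis .
qed

lemma block_vec_index:
  "i < q \<Longrightarrow> k < m \<Longrightarrow> block_vec m q v $ (i * m + k) = v i $ k"
  by (simp add: block_vec_def block_index_less)

lemma block_vec_eq_0_iff:
  assumes "\<And>i. i < q \<Longrightarrow> v i \<in> carrier_vec m"
  shows "block_vec m q v = 0\<^sub>v (q * m) \<longleftrightarrow> (\<forall>i<q. v i = 0\<^sub>v m)"
proof (intro iffI allI impI)
  fix i assume eq: "block_vec m q v = 0\<^sub>v (q * m)" and i: "i < q"
  show "v i = 0\<^sub>v m"
  proof (rule eq_vecI)
    fix k assume "k < dim_vec (0\<^sub>v m)"
    then show "v i $ k = 0\<^sub>v m $ k"
      using block_vec_index[of i q k m v] block_index_less[of i q k m] i by (simp add: eq)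
  qed (use assms[OF i] in auto)
next
  assume "\<forall>i<q. v i = 0\<^sub>v m"
  then show "block_vec m q v = 0\<^sub>v (q * m)"
    by (intro eq_vecI, cases "m = 0") (auto simp: block_vec_def less_mult_imp_div_less)
qed

text \<open>
  A position below \<open>q * m\<close> is a block number together with an offset. This splits a row of a
  \<open>q * m\<close> square matrix times a block vector into one sum for each block.
\<close>

lemma sum_over_blocks:
  fixes f :: "nat \<Rightarrow> nat \<Rightarrow> 'a :: comm_monoid_add"
  shows "(\<Sum>c<q * m. f (c div m) (c mod m)) = (\<Sum>j<q. \<Sum>k<m. f j k)"
proof (induction q)
  case (Suc q)
  have "(\<Sum>c<Suc q * m. f (c div m) (c mod m)) =
      (\<Sum>c<q * m. f (c div m) (c mod m)) + (\<Sum>k<m. f ((q * m + k) div m) ((q * m + k) mod m))"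
    using sum.nat_group[of "\<lambda>c. f (c div m) (c mod m)" m "Suc q"]
      sum.nat_group[of "\<lambda>c. f (c div m) (c mod m)" m q]
      sum.shift_bounds_nat_ivl[of "\<lambda>c. f (c div m) (c mod m)" 0 "q * m" m]
    by (simp add: lessThan_atLeast0 ac_simps)
  also have "(\<Sum>k<m. f ((q * m + k) div m) ((q * m + k) mod m)) = (\<Sum>k<m. f q k)"
    by (intro sum.cong) auto
  finally show ?case by (simp add: Suc)
qed simp

lemma diag_block_mat_const_carrier:
  assumes "\<And>M. M \<in> set Ms \<Longrightarrow> M \<in> carrier_mat m m"
  shows "diag_block_mat Ms \<in> carrier_mat (length Ms * m) (length Ms * m)"
  using assms by (induction Ms) (auto simp: Let_def)

lemma index_diag_block_mat_const:
  assumes "\<And>M. M \<in> set Ms \<Longrightarrow> M \<in> carrier_mat m m" "r < length Ms * m" "c < length Ms * m"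
  shows "diag_block_mat Ms $$ (r, c) =
    (if r div m = c div m then (Ms ! (r div m)) $$ (r mod m, c mod m) else 0)"
  using assms
proof (induction Ms arbitrary: r c)
  case (Cons M Ms)
  have M: "M \<in> carrier_mat m m" and D: "diag_block_mat Ms \<in> carrier_mat (length Ms * m) (length Ms * m)"
    using Cons.prems diag_block_mat_const_carrier[of Ms m] by auto
  have m: "m > 0"
    using Cons.prems(2) by (cases m) auto
  have IH: "diag_block_mat Ms $$ (r - m, c - m) =
      (if r div m = c div m then (Ms ! (r div m - 1)) $$ (r mod m, c mod m) else 0)"
    if "m \<le> r" "m \<le> c"
  proof -
    have "diag_block_mat Ms $$ (r - m, c - m) =
      (if (r - m) div m = (c - m) div m then (Ms ! ((r - m) div m)) $$ ((r - m) mod m, (c - m) mod m) else 0)"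
      using Cons.prems that by (intro Cons.IH) auto
    then show ?thesis
      using that m by (simp add: le_div_geq le_mod_geq)
  qed
  have "diag_block_mat (M # Ms) $$ (r, c) = (if r < m then if c < m then M $$ (r, c) else 0
      else if c < m then 0 else diag_block_mat Ms $$ (r - m, c - m))"
    using carrier_matD[OF M] carrier_matD[OF D] Cons.prems(2,3) by (simp add: Let_def)
  then show ?case
    using IH m by (auto simp: nth_Cons' div_eq_0_iff)
qed simp

text \<open>
  The factor \<open>e \<otimes> I\<close> copies the block row \<open>[W]\<close> into every block row, so the second summand depends on
  \<open>r\<close> only through its offset \<open>r mod m\<close>.
\<close>

lemma index_linearization_mat:
  assumes B: "\<And>i. i < q \<Longrightarrow> B i \<in> carrier_mat m m" and W: "\<And>i. i < q \<Longrightarrow> W i \<in> carrier_mat m m"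
    and r: "r < q * m" and c: "c < q * m"
  shows "linearization_mat m q B W $$ (r, c) =
    (if r div m = c div m then B (r div m) $$ (r mod m, c mod m) else 0)
      + W (c div m) $$ (r mod m, c mod m)"
proof -
  have m: "m > 0" using r by (cases m) auto
  let ?K = "kronecker (mat q 1 (\<lambda>_. 1)) (1\<^sub>m m) :: complex poly mat"
  have "(?K * block_row m q W) $$ (r, c) =
      (\<Sum>k<m. (if r mod m = k then 1 else 0) * W (c div m) $$ (k, c mod m))"
    using r c m
    by (auto simp: kronecker_def block_row_def scalar_prod_def lessThan_atLeast0
      less_mult_imp_div_less intro!: sum.cong)
  also have "\<dots> = (\<Sum>k<m. if r mod m = k then W (c div m) $$ (k, c mod m) else 0)"
    by (intro sum.cong) auto
  also have "\<dots> = W (c div m) $$ (r mod m, c mod m)"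
    using m by simp
  finally have 1: "(?K * block_row m q W) $$ (r, c) = W (c div m) $$ (r mod m, c mod m)" .
  have 2: "?K * block_row m q W \<in> carrier_mat (q * m) (q * m)"
    by (auto simp: kronecker_def block_row_def)
  have 3: "diag_block_mat (map B [0..<q]) $$ (r, c) =
      (if r div m = c div m then B (r div m) $$ (r mod m, c mod m) else 0)"
    using r c B by (subst index_diag_block_mat_const[where m = m]) (auto simp: less_mult_imp_div_less)
  show ?thesis
    unfolding linearization_mat_def using r c 1 3 carrier_matD[OF 2] by (simp only: index_add_mat)
qed

lemma linearization_mat_carrier:
  "linearization_mat m q B W \<in> carrier_mat (q * m) (q * m)"
  by (intro carrier_matI) (simp_all add: linearization_mat_def kronecker_def block_row_def)

text \<open>
  The vector added to the block \<open>b i *\<^sub>v v i\<close> is the same for all \<open>i\<close>; this common vector is what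
  links the kernel of the linearization to a single vector in the kernel of \<open>P\<close>.
\<close>

lemma eval_linearization_mult_block_vec:
  assumes B: "\<And>i. i < q \<Longrightarrow> B i \<in> carrier_mat m m" and W: "\<And>i. i < q \<Longrightarrow> W i \<in> carrier_mat m m"
    and v: "\<And>i. i < q \<Longrightarrow> v i \<in> carrier_vec m"
  shows "eval_matpoly (linearization_mat m q B W) z *\<^sub>v block_vec m q v =
    block_vec m q (\<lambda>i. eval_matpoly (B i) z *\<^sub>v v i +
      finsum_vec TYPE(complex) m (\<lambda>j. eval_matpoly (W j) z *\<^sub>v v j) {..<q})"
    (is "?A *\<^sub>v _ = block_vec m q (\<lambda>i. ?b i *\<^sub>v v i + ?s)")
proof (rule eq_vecI)
  have A: "linearization_mat m q B W \<in> carrier_mat (q * m) (q * m)"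
    by (rule linearization_mat_carrier)
  then show "dim_vec (?A *\<^sub>v block_vec m q v) = dim_vec (block_vec m q (\<lambda>i. ?b i *\<^sub>v v i + ?s))"
    by (simp add: block_vec_def eval_matpoly_def)
  fix r assume "r < dim_vec (block_vec m q (\<lambda>i. ?b i *\<^sub>v v i + ?s))"
  then have r: "r < q * m" by (simp add: block_vec_def)
  then have m: "m > 0" by (cases m) auto
  define i k where "i = r div m" and "k = r mod m"
  have i: "i < q" and k: "k < m"
    using r m by (auto simp: i_def k_def less_mult_imp_div_less)
  have s: "?s \<in> carrier_vec m"
    using W v by (intro finsum_vec_carrier mult_mat_vec_carrier) auto
  have "(?A *\<^sub>v block_vec m q v) $ r = (\<Sum>c<q * m. poly (linearization_mat m q B W $$ (r, c)) z
      * v (c div m) $ (c mod m))"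
    using A r by (auto simp: scalar_prod_def block_vec_def eval_matpoly_def lessThan_atLeast0)
  also have "\<dots> = (\<Sum>c<q * m. (\<lambda>j l. ((if i = j then poly (B i $$ (k, l)) z else 0)
      + poly (W j $$ (k, l)) z) * v j $ l) (c div m) (c mod m))"
    using r B W by (intro sum.cong refl) (auto simp: index_linearization_mat i_def k_def)
  also have "\<dots> = (\<Sum>j<q. \<Sum>l<m. ((if i = j then poly (B i $$ (k, l)) z else 0)
      + poly (W j $$ (k, l)) z) * v j $ l)"
    by (rule sum_over_blocks)
  also have "\<dots> = (\<Sum>j<q. if i = j then (\<Sum>l<m. poly (B i $$ (k, l)) z * v j $ l) else 0)
      + (\<Sum>j<q. \<Sum>l<m. poly (W j $$ (k, l)) z * v j $ l)"
    unfolding sum.distrib[symmetric]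
    by (intro sum.cong refl) (auto simp: algebra_simps sum.distrib)
  also have "(\<Sum>j<q. if i = j then (\<Sum>l<m. poly (B i $$ (k, l)) z * v j $ l) else 0) = (?b i *\<^sub>v v i) $ k"
    using i k B[OF i] v[OF i] by (auto simp: scalar_prod_def eval_matpoly_def lessThan_atLeast0)
  also have "(\<Sum>j<q. \<Sum>l<m. poly (W j $$ (k, l)) z * v j $ l) = ?s $ k"
  proof -
    have "?s $ k = (\<Sum>j<q. (eval_matpoly (W j) z *\<^sub>v v j) $ k)"
      using k W v by (intro index_finsum_vec) (auto intro!: mult_mat_vec_carrier[of _ m m])
    also have "\<dots> = (\<Sum>j<q. \<Sum>l<m. poly (W j $$ (k, l)) z * v j $ l)"
    proof (intro sum.cong refl)
      fix j assume "j \<in> {..<q}"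
      then have "W j \<in> carrier_mat m m" "v j \<in> carrier_vec m" using W v by auto
      then show "(eval_matpoly (W j) z *\<^sub>v v j) $ k = (\<Sum>l<m. poly (W j $$ (k, l)) z * v j $ l)"
        using k by (auto simp: scalar_prod_def eval_matpoly_def lessThan_atLeast0)
    qed
    finally show ?thesis by (rule sym)
  qed
  finally show "(?A *\<^sub>v block_vec m q v) $ r = block_vec m q (\<lambda>i. ?b i *\<^sub>v v i + ?s) $ r"
    using r s k B[OF i] by (simp add: block_vec_def i_def k_def)
qed

section \<open>Kernel vectors of the linearization and of the matrix polynomial\<close>

theorem theorem3p1:
  fixes m n q :: nat
    and P :: "complex poly mat"
    and C :: "nat \<Rightarrow> complex mat"
    and B W :: "nat \<Rightarrow> complex poly mat"
    and z :: complex
  assumes C_carrier: "\<And>i. i \<le> n \<Longrightarrow> C i \<in> carrier_mat m m"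
    and P_coeffs: "P = matpoly_of_coeffs m n C"
    and P_degree: "C n \<noteq> 0\<^sub>m m m"
    and P_regular: "regular_matpoly P"
    and q: "0 < q" "q \<le> n"
    and B_carrier: "\<And>i. i < q \<Longrightarrow> B i \<in> carrier_mat m m"
    and W_carrier: "\<And>i. i < q \<Longrightarrow> W i \<in> carrier_mat m m"
    and P_decomp: "P = prod_list_mat m (map B [0..<q]) +
      finsum_mat TYPE(complex poly) m m
        (\<lambda>i. W i * prod_list_mat m (map B (filter (\<lambda>j. j \<noteq> i) [0..<q]))) {..<q}"
    and B_regular: "\<And>i. i < q \<Longrightarrow> regular_matpoly (B i)"
    and B_commute: "\<And>i j. i < q \<Longrightarrow> j < q \<Longrightarrow> B i * B j = B j * B i"
    and B_coprime: "\<And>i j. i < q \<Longrightarrow> j < q \<Longrightarrow> i \<noteq> j \<Longrightarrow> right_coprime m (B i) (B j)"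
    and P_singular: "det (eval_matpoly P z) = 0"
    and B_nonsingular: "\<And>i. i < q \<Longrightarrow> det (eval_matpoly (B i) z) \<noteq> 0"
  shows
    "(\<forall>vs. (\<forall>i<q. vs i \<in> carrier_vec m) \<longrightarrow>
        block_vec m q vs \<noteq> 0\<^sub>v (q * m) \<longrightarrow>
        eval_matpoly (linearization_mat m q B W) z *\<^sub>v block_vec m q vs = 0\<^sub>v (q * m) \<longrightarrow>
        (let v = - (prod_list_mat m (map (\<lambda>i. the (mat_inverse (eval_matpoly (B i) z))) [0..<q]) *\<^sub>v
                    finsum_vec TYPE(complex) m (\<lambda>j. eval_matpoly (W j) z *\<^sub>v vs j) {..<q})
         in v \<noteq> 0\<^sub>v m \<and> eval_matpoly P z *\<^sub>v v = 0\<^sub>v m)) \<and>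
     (\<forall>v \<in> carrier_vec m. v \<noteq> 0\<^sub>v m \<longrightarrow> eval_matpoly P z *\<^sub>v v = 0\<^sub>v m \<longrightarrow>
        (let vA = block_vec m q
               (\<lambda>i. prod_list_mat m (map (\<lambda>j. eval_matpoly (B j) z) (filter (\<lambda>j. j \<noteq> i) [0..<q])) *\<^sub>v v)
         in vA \<noteq> 0\<^sub>v (q * m) \<and>
            eval_matpoly (linearization_mat m q B W) z *\<^sub>v vA = 0\<^sub>v (q * m)))"
proof -
  define b w where "b = (\<lambda>i. eval_matpoly (B i) z)" and "w = (\<lambda>i. eval_matpoly (W i) z)"
  define c where "c = (\<lambda>i. the (mat_inverse (b i)))"
  define N where "N = prod_list_mat m (map b [0..<q])"
  define D where "D = prod_list_mat m (map c [0..<q])"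
  define N' where "N' = (\<lambda>i. prod_list_mat m (map b (filter (\<lambda>j. j \<noteq> i) [0..<q])))"
  define s where "s = (\<lambda>u. finsum_vec TYPE(complex) m (\<lambda>j. w j *\<^sub>v u j) {..<q})"

  have b: "b i \<in> carrier_mat m m" and w: "w i \<in> carrier_mat m m" if "i < q" for i
    using B_carrier W_carrier that by (auto simp: b_def w_def)
  have c: "c i \<in> carrier_mat m m" "c i * b i = 1\<^sub>m m" "b i * c i = 1\<^sub>m m" if "i < q" for i
    using mat_inverse_of_det_nonzero[OF b[OF that]] B_nonsingular[OF that]
    by (auto simp: c_def b_def)
  have cb_vec: "c i *\<^sub>v (b i *\<^sub>v x) = x" if i: "i < q" and x: "x \<in> carrier_vec m" for i x
    using assoc_mult_mat_vec[OF c(1)[OF i] b[OF i] x] c(2)[OF i] x by simp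
  have b_comm: "b i * b j = b j * b i" if "i < q" "j < q" for i j
    using B_commute[OF that] eval_matpoly_mult[OF B_carrier B_carrier] that
    unfolding b_def by metis
  have bc_comm: "b i * c j = c j * b i" if "i < q" "j < q" for i j
    by (rule commute_inverse_mat[of _ m "b j"]) (use that b c b_comm in auto)
  have N: "N \<in> carrier_mat m m" and D: "D \<in> carrier_mat m m"
    unfolding N_def D_def using b c by (auto intro!: prod_list_mat_carrier)
  have N': "N' i \<in> carrier_mat m m" for i
    unfolding N'_def using b by (auto intro!: prod_list_mat_carrier)
  have N_factor: "N = b i * N' i" if "i < q" for i
    unfolding N_def N'_def using that b b_comm by (intro prod_list_mat_factor_out) auto
  have N_factor_vec: "b i *\<^sub>v (N' i *\<^sub>v v) = N *\<^sub>v v" if "i < q" "v \<in> carrier_vec m" for i v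
    unfolding N_factor[OF that(1)] using b[OF that(1)] N' that(2) by (rule assoc_mult_mat_vec[symmetric])
  have DN: "D * N = 1\<^sub>m m"
    unfolding N_def D_def using b c bc_comm by (intro prod_list_mat_left_inverse) auto
  have ND: "N * D = 1\<^sub>m m"
    unfolding N_def D_def using b c bc_comm by (intro prod_list_mat_left_inverse) auto
  have s_carrier: "s u \<in> carrier_vec m" if "\<And>i. i < q \<Longrightarrow> u i \<in> carrier_vec m" for u
    unfolding s_def using w that by (intro finsum_vec_carrier mult_mat_vec_carrier) auto

  have Pv: "eval_matpoly P z *\<^sub>v v = N *\<^sub>v v + s (\<lambda>i. N' i *\<^sub>v v)" if v: "v \<in> carrier_vec m" for v
  proof -
    let ?R = "\<lambda>i. prod_list_mat m (map B (filter (\<lambda>j. j \<noteq> i) [0..<q]))"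
    let ?F = "finsum_mat TYPE(complex poly) m m (\<lambda>i. W i * ?R i) {..<q}"
    have R: "?R i \<in> carrier_mat m m" "prod_list_mat m (map B [0..<q]) \<in> carrier_mat m m" for i
      using B_carrier by (auto intro!: prod_list_mat_carrier)
    have F: "?F \<in> carrier_mat m m"
      using W_carrier R by (intro finsum_mat_carrier) (auto intro!: mult_carrier_mat)
    have N_eval: "eval_matpoly (prod_list_mat m (map B [0..<q])) z = N"
      using B_carrier by (subst eval_matpoly_prod_list) (auto simp: N_def b_def o_def)
    have N'_eval: "eval_matpoly (?R i) z = N' i" for i
      using B_carrier by (subst eval_matpoly_prod_list) (auto simp: N'_def b_def o_def)
    have "eval_matpoly P z *\<^sub>v v = N *\<^sub>v v + eval_matpoly ?F z *\<^sub>v v"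
      unfolding P_decomp eval_matpoly_add[OF R(2) F] N_eval
      using N F v by (intro add_mult_distrib_mat_vec) auto
    also have "eval_matpoly ?F z *\<^sub>v v = s (\<lambda>i. N' i *\<^sub>v v)"
      using W_carrier R v
      by (subst eval_matpoly_finsum_mult_vec[where k = m]) (auto simp: s_def w_def N'_eval)
    finally show ?thesis .
  qed
  have Av: "eval_matpoly (linearization_mat m q B W) z *\<^sub>v block_vec m q u = 0\<^sub>v (q * m) \<longleftrightarrow>
      (\<forall>i<q. b i *\<^sub>v u i + s u = 0\<^sub>v m)" if u: "\<And>i. i < q \<Longrightarrow> u i \<in> carrier_vec m" for u
    using eval_linearization_mult_block_vec[of q B m W u z] B_carrier W_carrier u b s_carrier[of u]
    by (subst block_vec_eq_0_iff[symmetric])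
      (auto simp: b_def w_def s_def intro!: add_carrier_vec mult_mat_vec_carrier[of _ m m])

  show ?thesis
    unfolding Let_def b_def[symmetric, THEN fun_cong] w_def[symmetric, THEN fun_cong]
  proof (intro conjI allI ballI impI)
    fix vs assume vs: "\<forall>i<q. vs i \<in> carrier_vec m" and nz: "block_vec m q vs \<noteq> 0\<^sub>v (q * m)"
      and "eval_matpoly (linearization_mat m q B W) z *\<^sub>v block_vec m q vs = 0\<^sub>v (q * m)"
    then have eqs: "\<And>i. i < q \<Longrightarrow> b i *\<^sub>v vs i + s vs = 0\<^sub>v m"
      using Av by auto
    have sv: "s vs \<in> carrier_vec m" using vs by (intro s_carrier) auto
    define v where "v = - (D *\<^sub>v s vs)"
    have v: "v \<in> carrier_vec m" using D sv by (simp add: v_def)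
    have "N *\<^sub>v v = - (N *\<^sub>v (D *\<^sub>v s vs))"
      using N D sv by (intro eq_vecI) (auto simp: v_def)
    also have "\<dots> = - s vs"
      using N D sv ND by (simp flip: assoc_mult_mat_vec)
    finally have Nv: "N *\<^sub>v v = - s vs" .
    \<comment> \<open>Both sides have the image \<open>- s vs\<close> under the invertible matrix \<open>b i\<close>.\<close>
    have N'v: "N' i *\<^sub>v v = vs i" if i: "i < q" for i
    proof -
      have "b i *\<^sub>v (N' i *\<^sub>v v) = - s vs"
        using Nv by (simp add: N_factor_vec[OF i v])
      also have "\<dots> = b i *\<^sub>v vs i"
        using eqs[OF i] b[OF i] vs i sv by (intro uminus_vec_eqI[of _ m]) auto
      finally have "c i *\<^sub>v (b i *\<^sub>v (N' i *\<^sub>v v)) = c i *\<^sub>v (b i *\<^sub>v vs i)" by simp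
      then show ?thesis
        using N'[of i] v vs i by (simp add: cb_vec[OF i])
    qed
    \<comment> \<open>Hence the \<open>W\<close>-part of \<open>P\<close>, applied to \<open>v\<close>, is exactly what cancels \<open>N *\<^sub>v v\<close>.\<close>
    have s_N'v: "s (\<lambda>i. N' i *\<^sub>v v) = s vs"
      unfolding s_def using N'v vs w
      by (intro finsum_vec_cong) (auto intro!: mult_mat_vec_carrier)
    have "eval_matpoly P z *\<^sub>v v = - s vs + s vs"
      using Pv[OF v] Nv s_N'v by simp
    then have "eval_matpoly P z *\<^sub>v v = 0\<^sub>v m"
      using sv by simp
    moreover have "v \<noteq> 0\<^sub>v m"
    proof
      assume "v = 0\<^sub>v m"
      then have "\<forall>i<q. vs i = 0\<^sub>v m"
        using N'v by (auto simp: mult_mat_vec_zero[OF N'])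
      then show False using nz vs by (simp add: block_vec_eq_0_iff)
    qed
    ultimately show
      "- (prod_list_mat m (map (\<lambda>i. the (mat_inverse (b i))) [0..<q]) *\<^sub>v
        finsum_vec TYPE(complex) m (\<lambda>j. w j *\<^sub>v vs j) {..<q}) \<noteq> 0\<^sub>v m"
      "eval_matpoly P z *\<^sub>v - (prod_list_mat m (map (\<lambda>i. the (mat_inverse (b i))) [0..<q]) *\<^sub>v
        finsum_vec TYPE(complex) m (\<lambda>j. w j *\<^sub>v vs j) {..<q}) = 0\<^sub>v m"
      by (simp_all add: v_def D_def c_def s_def)
  next
    fix v :: "complex vec"
    assume v: "v \<in> carrier_vec m" and nz: "v \<noteq> 0\<^sub>v m" and "eval_matpoly P z *\<^sub>v v = 0\<^sub>v m"
    then have P0: "N *\<^sub>v v + s (\<lambda>i. N' i *\<^sub>v v) = 0\<^sub>v m"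
      using Pv by simp
    have u: "N' i *\<^sub>v v \<in> carrier_vec m" for i
      using N' v by (rule mult_mat_vec_carrier)
    \<comment> \<open>A nonzero block exists because \<open>0 < q\<close>: block \<open>0\<close> cannot vanish, since \<open>N\<close> is injective and
      factors through \<open>N' 0\<close>.\<close>
    have "D *\<^sub>v (N *\<^sub>v v) = v"
      using D N v DN by (simp flip: assoc_mult_mat_vec)
    then have "b 0 *\<^sub>v (N' 0 *\<^sub>v v) \<noteq> 0\<^sub>v m"
      using nz by (auto simp: N_factor_vec[OF q(1) v] mult_mat_vec_zero[OF D])
    then have "N' 0 *\<^sub>v v \<noteq> 0\<^sub>v m"
      by (auto simp: mult_mat_vec_zero[OF b[OF q(1)]])
    then show "block_vec m q (\<lambda>i. prod_list_mat m (map b (filter (\<lambda>j. j \<noteq> i) [0..<q])) *\<^sub>v v) \<noteq> 0\<^sub>v (q * m)"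
      using u q(1) unfolding N'_def[symmetric, THEN fun_cong] by (subst block_vec_eq_0_iff) auto
    show "eval_matpoly (linearization_mat m q B W) z *\<^sub>v
        block_vec m q (\<lambda>i. prod_list_mat m (map b (filter (\<lambda>j. j \<noteq> i) [0..<q])) *\<^sub>v v) = 0\<^sub>v (q * m)"
      unfolding N'_def[symmetric, THEN fun_cong] Av[OF u]
    proof (intro allI impI)
      fix i assume i: "i < q"
      have "b i *\<^sub>v (N' i *\<^sub>v v) = N *\<^sub>v v"
        by (rule N_factor_vec[OF i v])
      then show "b i *\<^sub>v (N' i *\<^sub>v v) + s (\<lambda>i. N' i *\<^sub>v v) = 0\<^sub>v m"
        using P0 by simp
    qed
  qed
qed

end
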